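(* Let $d\ge 1$, let $X=\mathbb{R}^d$, and let $\mathcal{S}_d$ be the family of all spheres in $\mathbb{R}^d$. Then $$\eta(X,\mathcal{S}_d)=\eta^\infty(X,\mathcal{S}_d)=d+2.$$
   Context: A sphere in $\mathbb{R}^d$ is a set of the form $\{x\in\mathbb{R}^d:\|x-c\|=r\}$ with $c\in\mathbb{R}^d$ and $r>0$, where $\|\cdot\|$ is the Euclidean norm (the paper calls these "$d$-dimensional spheres"). For a set $X$ and a family $\mathscr{F}$ of subsets of $X$, the colorful Helly number $\eta(X,\mathscr{F})$ is the minimum positive integer $\eta$ for which the following holds: whenever finite subfamilies $\mathscr{F}_1,\ldots,\mathscr{F}_\eta\subset\mathscr{F}$ (not necessarily distinct) satisfy $\bigcap_{F\in\mathscr{F}_i}F=\emptyset$ for every $i=1,\ldots,\eta$, there exist $F_i\in\mathscr{F}_i$ ($1\le i\le\eta$) such that $F_1\cap\cdots\cap F_\eta=\emptyset$ (and $\eta(X,\mathscr{F})=\infty$ if no such integer exists). The number $\eta^\infty(X,\mathscr{F})$ is defined in the same way, except that the subfamilies $\mathscr{F}_i$ are not required to be finite. The intersection of an empty subfamily is understood to be $X$. *)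

theory Defs
  imports "HOL-Analysis.Analysis" "HOL-Library.Extended_Nat"
begin

definition family_Inter :: "'a set \<Rightarrow> 'a set set \<Rightarrow> 'a set" where
  "family_Inter X G = X \<inter> \<Inter>G"  (* equals X for the empty subfamily *)

definition colorful_Helly_finite :: "'a set \<Rightarrow> 'a set set \<Rightarrow> nat \<Rightarrow> bool" where
  "colorful_Helly_finite X \<F> n \<longleftrightarrow>
    (\<forall>G :: nat \<Rightarrow> 'a set set.
      (\<forall>i\<in>{1..n}. G i \<subseteq> \<F> \<and> finite (G i) \<and> family_Inter X (G i) = {}) \<longrightarrow>
      (\<exists>F :: nat \<Rightarrow> 'a set. (\<forall>i\<in>{1..n}. F i \<in> G i) \<and> (\<Inter>i\<in>{1..n}. F i) = {}))"

definition colorful_Helly_infinite :: "'a set \<Rightarrow> 'a set set \<Rightarrow> nat \<Rightarrow> bool" where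
  "colorful_Helly_infinite X \<F> n \<longleftrightarrow>
    (\<forall>G :: nat \<Rightarrow> 'a set set.
      (\<forall>i\<in>{1..n}. G i \<subseteq> \<F> \<and> family_Inter X (G i) = {}) \<longrightarrow>
      (\<exists>F :: nat \<Rightarrow> 'a set. (\<forall>i\<in>{1..n}. F i \<in> G i) \<and> (\<Inter>i\<in>{1..n}. F i) = {}))"

text \<open>On \<^typ>\<open>enat\<close> the infimum of a nonempty set is its minimum, and the infimum of the
  empty set is \<open>\<infinity>\<close>.\<close>

definition eta :: "'a set \<Rightarrow> 'a set set \<Rightarrow> enat" where
  "eta X \<F> = Inf {enat n | n. n \<ge> 1 \<and> colorful_Helly_finite X \<F> n}"

definition eta_inf :: "'a set \<Rightarrow> 'a set set \<Rightarrow> enat" where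
  "eta_inf X \<F> = Inf {enat n | n. n \<ge> 1 \<and> colorful_Helly_infinite X \<F> n}"

definition spheres :: "(real ^ 'n) set set" where
  "spheres = {sphere c r | c r. r > 0}"

end

theory Submission imports Defs begin

text \<open>
  Let \<open>d\<close> be the dimension of the space.

  Upper bound. Subtracting the equations of two spheres leaves an affine equation, so on a set that
  already lies in one sphere, intersecting with another sphere amounts to intersecting with a
  hyperplane. If some point of the set is missed, the affine dimension therefore drops
  (\<open>aff_dim_Int_sphere_less\<close>). A family with empty intersection always has a member missing a given
  point of the intersection built so far, so a greedy choice of one sphere per family lowers the
  dimension from at most \<open>d\<close> after the first sphere to \<open>-1\<close>, the dimension of the empty set, after
  \<open>d + 2\<close> of them (\<open>greedy_rainbow_choice\<close>). The choice is made the same way for finite and infinite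
  families, so it bounds both numbers.

  Lower bound. There are \<open>d + 2\<close> spheres without a common point such that omitting any one of them
  leaves a common point (\<open>witness_sphere\<close>, \<open>witness_point\<close>). Using this same family for each of at
  most \<open>d + 1\<close> colours, every rainbow choice omits one of the spheres and hence has a common point
  (\<open>critical_family_not_colorful_Helly\<close>).
\<close>

lemma mem_sphere_inner:
  fixes c :: "'a::real_inner"
  assumes "r \<ge> 0"
  shows "x \<in> sphere c r \<longleftrightarrow> x \<bullet> x - 2 * (c \<bullet> x) + c \<bullet> c = r\<^sup>2"
proof -
  have "x \<in> sphere c r \<longleftrightarrow> (dist c x)\<^sup>2 = r\<^sup>2"
    using assms by simp
  also have "(dist c x)\<^sup>2 = x \<bullet> x - 2 * (c \<bullet> x) + c \<bullet> c"
    by (simp add: dist_norm power2_norm_eq_inner inner_diff inner_commute)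
  finally show ?thesis .
qed

text \<open>The two spheres meet in the hyperplane obtained by subtracting their equations (their radical
  hyperplane), and that hyperplane meets the first sphere only inside the second. Hence \<open>p\<close> lies
  outside an affine set containing the new intersection. For concentric
  spheres the radical hyperplane degenerates to the empty set, as \<open>p\<close> lies on only one of them.\<close>

lemma aff_dim_Int_sphere_less:
  fixes A :: "'a::euclidean_space set"
  assumes A: "A \<subseteq> sphere c r" and r: "r \<ge> 0" and r': "r' \<ge> 0"
    and p: "p \<in> A" "p \<notin> sphere c' r'"
  shows "aff_dim (A \<inter> sphere c' r') < aff_dim A"
proof -
  define H where "H = {x. (2 *\<^sub>R (c' - c)) \<bullet> x = r\<^sup>2 - r'\<^sup>2 + c' \<bullet> c' - c \<bullet> c}"
  have H: "x \<in> sphere c' r' \<longleftrightarrow> x \<in> H" if "x \<in> A" for x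
  proof -
    have "x \<bullet> x - 2 * (c \<bullet> x) + c \<bullet> c = r\<^sup>2"
      using that A r mem_sphere_inner by blast
    then show ?thesis
      unfolding mem_sphere_inner[OF r'] H_def by (auto simp: inner_diff_left algebra_simps)
  qed
  have "affine H"
    unfolding H_def by (rule affine_hyperplane)
  then have "affine hull (A \<inter> sphere c' r') \<subseteq> H"
    using H by (intro hull_minimal) auto
  then have "p \<notin> affine hull (A \<inter> sphere c' r')"
    using H p by blast
  then have "aff_dim (A \<inter> sphere c' r') < aff_dim (insert p (A \<inter> sphere c' r'))"
    by (simp add: aff_dim_insert)
  also have "\<dots> \<le> aff_dim A"
    using p by (intro aff_dim_subset) auto
  finally show ?thesis .
qed

text \<open>The bound counts from the first sphere, since only inside a sphere does a further sphere act as
  a hyperplane: the first one may well leave the affine dimension at \<open>d\<close>. The maximum accounts for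
  an intersection that has become empty early.\<close>

lemma greedy_rainbow_choice:
  fixes G :: "nat \<Rightarrow> (real ^ 'n) set set"
  assumes "m \<ge> 1"
    and "\<forall>i\<in>{1..m}. G i \<subseteq> spheres \<and> \<Inter>(G i) = {}"
  shows "\<exists>F. (\<forall>i\<in>{1..m}. F i \<in> G i) \<and>
    aff_dim (\<Inter>i\<in>{1..m}. F i) \<le> max (-1) (int CARD('n) + 1 - int m)"
  using assms
proof (induction m rule: nat_induct_at_least)
  case base
  then obtain S where "S \<in> G 1" by fastforce
  then show ?case
    using aff_dim_le_DIM[of S] by (intro exI[of _ "\<lambda>_. S"]) (simp add: max_def)
next
  case (Suc m)
  then obtain F where F: "\<forall>i\<in>{1..m}. F i \<in> G i"
    and dim: "aff_dim (\<Inter>i\<in>{1..m}. F i) \<le> max (-1) (int CARD('n) + 1 - int m)"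
    by auto
  define A where "A = (\<Inter>i\<in>{1..m}. F i)"
  have G: "G (Suc m) \<subseteq> spheres" "\<Inter>(G (Suc m)) = {}"
    using Suc.prems by auto
  have "\<exists>S\<in>G (Suc m). aff_dim (A \<inter> S) \<le> max (-1) (int CARD('n) + 1 - int (Suc m))"
  proof (cases "A = {}")
    case True
    obtain S where "S \<in> G (Suc m)" using G(2) by fastforce
    then show ?thesis using True by (intro bexI[of _ S]) auto
  next
    case False
    then obtain p where p: "p \<in> A" by blast
    obtain S where S: "S \<in> G (Suc m)" "p \<notin> S" using G(2) by blast
    obtain c' r' where S': "S = sphere c' r'" "r' > 0"
      using S(1) G(1) unfolding spheres_def by blast
    have "F 1 \<in> spheres"
      using F Suc.hyps Suc.prems by force
    then obtain c r where "F 1 = sphere c r" "r > 0"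
      unfolding spheres_def by blast
    moreover have "A \<subseteq> F 1"
      using Suc.hyps unfolding A_def by auto
    ultimately have "aff_dim (A \<inter> S) < aff_dim A"
      using S S' p aff_dim_Int_sphere_less[of A c r r' p c'] by auto
    then show ?thesis
      using S(1) dim unfolding A_def[symmetric] by (intro bexI[of _ S]) auto
  qed
  then obtain S where S: "S \<in> G (Suc m)"
    "aff_dim (A \<inter> S) \<le> max (-1) (int CARD('n) + 1 - int (Suc m))"
    by blast
  have "(\<Inter>i\<in>{1..Suc m}. (F(Suc m := S)) i) = A \<inter> S"
    unfolding A_def by (auto simp: atLeastAtMostSuc_conv)
  then show ?case
    using F S by (intro exI[of _ "F(Suc m := S)"]) auto
qed

lemma spheres_colorful_Helly_infinite:
  "colorful_Helly_infinite (UNIV :: (real ^ 'n) set) spheres (CARD('n) + 2)"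
  unfolding colorful_Helly_infinite_def family_Inter_def
proof (intro allI impI)
  fix G :: "nat \<Rightarrow> (real ^ 'n) set set"
  assume "\<forall>i\<in>{1..CARD('n) + 2}. G i \<subseteq> spheres \<and> UNIV \<inter> \<Inter>(G i) = {}"
  then obtain F where "\<forall>i\<in>{1..CARD('n) + 2}. F i \<in> G i"
    and dim: "aff_dim (\<Inter>i\<in>{1..CARD('n) + 2}. F i) \<le> -1"
    using greedy_rainbow_choice[of "CARD('n) + 2" G] by auto
  moreover from dim have "(\<Inter>i\<in>{1..CARD('n) + 2}. F i) = {}"
    using aff_dim_geq[of "\<Inter>i\<in>{1..CARD('n) + 2}. F i"] aff_dim_empty by (metis order_antisym)
  ultimately show "\<exists>F. (\<forall>i\<in>{1..CARD('n) + 2}. F i \<in> G i) \<and> (\<Inter>i\<in>{1..CARD('n) + 2}. F i) = {}"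
    by blast
qed

lemma colorful_Helly_infinite_imp_finite:
  "colorful_Helly_infinite X \<F> n \<Longrightarrow> colorful_Helly_finite X \<F> n"
  unfolding colorful_Helly_infinite_def colorful_Helly_finite_def
  by (intro allI impI, erule allE, erule mp) simp

text \<open>Indexing the family, rather than counting its members, makes it immaterial whether the sets
  \<open>S k\<close> are distinct: fewer colours than indices leave some index \<open>k\<close> unused, and \<open>p k\<close> is then a
  common point of the rainbow choice.\<close>

lemma critical_family_not_colorful_Helly:
  fixes S :: "'k::finite \<Rightarrow> 'a set"
  assumes S: "range S \<subseteq> \<F>" and empty: "\<Inter>(range S) = {}"
    and p: "\<And>j k. j \<noteq> k \<Longrightarrow> p k \<in> S j"
    and n: "n < CARD('k)"
  shows "\<not> colorful_Helly_finite X \<F> n"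
proof
  assume "colorful_Helly_finite X \<F> n"
  moreover have "\<forall>i\<in>{1..n}. range S \<subseteq> \<F> \<and> finite (range S) \<and> family_Inter X (range S) = {}"
    using S empty by (auto simp: family_Inter_def)
  ultimately have "\<exists>F. (\<forall>i\<in>{1..n}. F i \<in> range S) \<and> (\<Inter>i\<in>{1..n}. F i) = {}"
    unfolding colorful_Helly_finite_def by (elim allE[where x = "\<lambda>_. range S"]) blast
  then obtain F where F: "\<forall>i\<in>{1..n}. F i \<in> range S" "(\<Inter>i\<in>{1..n}. F i) = {}"
    by blast
  from F(1) have "\<forall>i\<in>{1..n}. \<exists>k. F i = S k"
    by blast
  then obtain f where f: "\<forall>i\<in>{1..n}. F i = S (f i)"
    by (auto dest!: bchoice)
  have "card (f ` {1..n}) < CARD('k)"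
    using card_image_le[of "{1..n}" f] n by simp
  then have "f ` {1..n} \<noteq> UNIV" by auto
  then obtain k where k: "k \<notin> f ` {1..n}" by blast
  have "p k \<in> S (f i)" if "i \<in> {1..n}" for i
    by (rule p) (use that k in auto)
  then have "p k \<in> (\<Inter>i\<in>{1..n}. F i)"
    using f by (intro INT_I) simp
  then show False using F(2) by blast
qed

text \<open>The points are the origin, the standard basis vectors and a negative multiple of the all-ones
  vector; the sphere indexed by \<open>k\<close> is the one through all points but \<open>witness_point k\<close>. In general,
  \<open>d + 2\<close> points of which no \<open>d + 1\<close> lie in a hyperplane and which do not all lie on one sphere would
  do: lifted to the paraboloid in \<open>d + 1\<close> dimensions they span a simplex, whose facet hyperplanes
  have no common point. The last point here is normalised so that the sphere missing the origin is
  the unit sphere.\<close>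

fun witness_point :: "'n::finite option option \<Rightarrow> real ^ 'n" where
  "witness_point None = 0"
| "witness_point (Some None) = (- 1 / sqrt (real CARD('n))) *\<^sub>R 1"
| "witness_point (Some (Some j)) = axis j 1"

fun witness_center :: "'n::finite option \<Rightarrow> real ^ 'n" where
  "witness_center None = (1 / 2) *\<^sub>R 1"
| "witness_center (Some j) =
     (1 / 2) *\<^sub>R (1 - (real CARD('n) + sqrt (real CARD('n))) *\<^sub>R axis j 1)"

fun witness_sphere :: "'n::finite option option \<Rightarrow> (real ^ 'n) set" where
  "witness_sphere None = sphere 0 1"
| "witness_sphere (Some k) = sphere (witness_center k) (norm (witness_center k))"

lemma mem_sphere_through_origin:
  fixes c :: "'a::real_inner"
  shows "x \<in> sphere c (norm c) \<longleftrightarrow> x \<bullet> x = 2 * (c \<bullet> x)"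
  by (subst mem_sphere_inner) (auto simp: power2_norm_eq_inner)

lemma inner_one_one: "(1 :: real ^ 'n) \<bullet> 1 = real CARD('n)"
  by (simp add: inner_vec_def)

lemma inner_one_axis: "(1 :: real ^ 'n) \<bullet> axis j 1 = 1"
  by (simp add: inner_axis)

lemma two_inner_witness_center:
  fixes x :: "real ^ 'n"
  shows "2 * (witness_center None \<bullet> x) = 1 \<bullet> x"
    and "2 * (witness_center (Some j) \<bullet> x)
      = 1 \<bullet> x - (real CARD('n) + sqrt (real CARD('n))) * x $ j"
  by (simp_all add: inner_diff_left inner_axis')

lemma witness_center_nonzero: "witness_center (k :: 'n::finite option) \<noteq> 0"
proof (cases k)
  case None
  then show ?thesis by (simp add: vec_eq_iff)
next
  case (Some j)
  have "real CARD('n) \<ge> 1" by (simp add: Suc_leI)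
  then have "real CARD('n) + sqrt (real CARD('n)) > 1"
    by (smt (verit) real_sqrt_gt_zero)
  then have "witness_center k $ j \<noteq> 0"
    using Some by simp
  then show ?thesis by auto
qed

lemma witness_sphere_in_spheres: "range (witness_sphere :: 'n::finite option option \<Rightarrow> _) \<subseteq> spheres"
proof
  fix S :: "(real ^ 'n) set"
  assume "S \<in> range witness_sphere"
  then obtain k where "S = witness_sphere k" by blast
  then show "S \<in> spheres"
    unfolding spheres_def
    by (cases k) (use zero_less_one in force, use witness_center_nonzero in fastforce)
qed

lemma witness_point_in_witness_sphere:
  fixes j k :: "'n::finite option option"
  assumes "j \<noteq> k"
  shows "witness_point k \<in> witness_sphere j"
proof -
  have sq: "sqrt (real CARD('n)) * sqrt (real CARD('n)) = real CARD('n)" "sqrt (real CARD('n)) > 0"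
    by simp_all
  show ?thesis
  proof (cases j)
    case None
    with assms show ?thesis
      by (cases k rule: witness_point.cases)
        (auto simp: norm_axis_1 norm_eq_sqrt_inner inner_one_one real_sqrt_divide field_simps)
  next
    case (Some i)
    have axis_nth: "axis a (1::real) $ b = (if b = a then 1 else 0)" for a b :: 'n
      by (simp add: axis_def)
    have "witness_point k \<bullet> witness_point k = 2 * (witness_center i \<bullet> witness_point k)"
      using assms Some sq
      by (cases k rule: witness_point.cases; cases i;
          simp only: two_inner_witness_center witness_point.simps)
        (auto simp: inner_one_one inner_one_axis inner_axis_axis axis_nth field_simps)
    then show ?thesis
      using Some by (simp add: mem_sphere_through_origin del: mem_sphere)
  qed
qed

text \<open>The equation of each sphere through the origin with a basis vector missing differs from that of
  the sphere through the origin and all basis vectors by a multiple of one coordinate. So these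
  spheres meet only in the origin, which is not on the unit sphere.\<close>

lemma Inter_witness_sphere: "\<Inter>(range (witness_sphere :: 'n::finite option option \<Rightarrow> _)) = {}"
proof (rule ccontr)
  assume "\<Inter>(range (witness_sphere :: 'n option option \<Rightarrow> _)) \<noteq> {}"
  then obtain x :: "real ^ 'n" where x: "\<And>k. x \<in> witness_sphere k" by blast
  have eq: "x \<bullet> x = 2 * (witness_center k \<bullet> x)" for k
    using x[of "Some k"] by (simp add: mem_sphere_through_origin del: mem_sphere)
  have "x $ j = 0" for j
  proof -
    have "(real CARD('n) + sqrt (real CARD('n))) * (x $ j) = 0"
      using eq[of None] eq[of "Some j"] unfolding two_inner_witness_center by simp
    moreover have "real CARD('n) + sqrt (real CARD('n)) > 0"
      by (simp add: add_pos_pos)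
    ultimately show ?thesis by simp
  qed
  then have "x = 0" by (simp add: vec_eq_iff)
  with x[of None] show False by simp
qed

lemma spheres_not_colorful_Helly_finite:
  assumes "n < CARD('n) + 2"
  shows "\<not> colorful_Helly_finite (UNIV :: (real ^ 'n) set) spheres n"
  using assms
  by (intro critical_family_not_colorful_Helly[where S = witness_sphere and p = witness_point]
      witness_sphere_in_spheres Inter_witness_sphere witness_point_in_witness_sphere)
    (simp_all add: card_UNIV_option)

lemma Inf_enat_eq_least:
  assumes "P N" and "\<And>n. n < N \<Longrightarrow> \<not> P n"
  shows "Inf {enat n | n. P n} = enat N"
proof (rule antisym)
  show "Inf {enat n | n. P n} \<le> enat N"
    using assms(1) by (intro Inf_lower) blast
  show "enat N \<le> Inf {enat n | n. P n}"
    using assms(2) by (intro Inf_greatest) (force intro: leI)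
qed

theorem mainTheorem6:
  shows "eta (UNIV :: (real ^ 'n) set) spheres = enat (CARD('n) + 2)
       \<and> eta_inf (UNIV :: (real ^ 'n) set) spheres = enat (CARD('n) + 2)"
proof
  show "eta (UNIV :: (real ^ 'n) set) spheres = enat (CARD('n) + 2)"
    unfolding eta_def
    using colorful_Helly_infinite_imp_finite[OF spheres_colorful_Helly_infinite]
      spheres_not_colorful_Helly_finite
    by (intro Inf_enat_eq_least) auto
  show "eta_inf (UNIV :: (real ^ 'n) set) spheres = enat (CARD('n) + 2)"
    unfolding eta_inf_def
    using spheres_colorful_Helly_infinite spheres_not_colorful_Helly_finite
    by (intro Inf_enat_eq_least) (auto dest: colorful_Helly_infinite_imp_finite)
qed

end
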